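(* Let $P_n$ and $C_n$ denote the path and the cycle on $n\ge3$ vertices. Then $t(P_n)\le t(C_n)\le 3k$ if $n\in(2\cdot3^{k-1},3^k]$ for some integer $k\ge1$; $t(P_n)\le t(C_n)\le 3k+1$ if $n\in(3^k,4\cdot3^{k-1}]$ for some integer $k\ge1$; and $t(P_n)\le t(C_n)\le 3k+2$ if $n\in(4\cdot3^{k-1},2\cdot3^k]$ for some integer $k\ge1$.
   Context: For a finite simple graph $G$, a $G$-CFF$(t,|V(G)|)$ is a family of subsets $B_v\subseteq[1,t]=\{1,\dots,t\}$, one for each vertex $v$, such that for every edge $\{a,b\}$: (i) $B_a\not\subseteq B_b$ and $B_b\not\subseteq B_a$, and (ii) for every vertex $w\notin\{a,b\}$, $B_w\not\subseteq B_a\cup B_b$. $t(G)$ is the minimum $t$ for which a $G$-CFF$(t,|V(G)|)$ exists. Intervals $(a,b]$ denote sets of integers $n$ with $a<n\le b$. *)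

theory Defs
  imports Main
begin

text \<open>A graph is a pair of its vertex set and its set of edges, each edge being an
  unordered pair of vertices.\<close>

type_synonym 'a graph = "'a set \<times> 'a set set"

abbreviation verts :: "'a graph \<Rightarrow> 'a set" where "verts \<equiv> fst"
abbreviation edges :: "'a graph \<Rightarrow> 'a set set" where "edges \<equiv> snd"

definition finite_simple_graph :: "'a graph \<Rightarrow> bool" where
  "finite_simple_graph G \<longleftrightarrow>
     finite (verts G) \<and>
     (\<forall>e\<in>edges G. \<exists>a b. e = {a, b} \<and> a \<noteq> b \<and> a \<in> verts G \<and> b \<in> verts G)"

definition is_graph_cff :: "'a graph \<Rightarrow> nat \<Rightarrow> ('a \<Rightarrow> nat set) \<Rightarrow> bool" where
  "is_graph_cff G t B \<longleftrightarrow>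
     (\<forall>v\<in>verts G. B v \<subseteq> {1..t}) \<and>
     (\<forall>a b. {a, b} \<in> edges G \<longrightarrow>
        \<not> B a \<subseteq> B b \<and> \<not> B b \<subseteq> B a \<and>
        (\<forall>w\<in>verts G. w \<notin> {a, b} \<longrightarrow> \<not> B w \<subseteq> B a \<union> B b))"

definition cff_number :: "'a graph \<Rightarrow> nat" where
  "cff_number G = (LEAST t. \<exists>B. is_graph_cff G t B)"

text \<open>The minimum defining \<^const>\<open>cff_number\<close> is attained on finite simple graphs:
  distinct singletons form a family with as many points as vertices.\<close>

lemma ex_graph_cff:
  assumes "finite_simple_graph G"
  shows "\<exists>t B. is_graph_cff G t B"
proof -
  have fin: "finite (verts G)"
    using assms by (simp add: finite_simple_graph_def)
  obtain f :: "'a \<Rightarrow> nat" where f: "bij_betw f (verts G) {1..card (verts G)}"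
    using fin by (metis ex_bij_betw_finite_nat bij_betw_iff_card finite_atLeastAtMost
        card_atLeastAtMost diff_Suc_1)
  have inj: "x = y" if "x \<in> verts G" "y \<in> verts G" "f x = f y" for x y
    using f that by (meson bij_betw_imp_inj_on inj_onD)
  have edge: "a \<noteq> b \<and> a \<in> verts G \<and> b \<in> verts G" if e: "{a, b} \<in> edges G" for a b
  proof -
    obtain c d where "{a, b} = {c, d}" "c \<noteq> d" "c \<in> verts G" "d \<in> verts G"
      using assms e unfolding finite_simple_graph_def by meson
    then show ?thesis by (auto simp: doubleton_eq_iff)
  qed
  have "is_graph_cff G (card (verts G)) (\<lambda>v. {f v})"
    unfolding is_graph_cff_def
  proof (intro conjI ballI allI impI)
    fix v assume "v \<in> verts G"
    then show "{f v} \<subseteq> {1..card (verts G)}"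
      using bij_betwE[OF f] by simp
  next
    fix a b assume "{a, b} \<in> edges G"
    from edge[OF this] show "\<not> {f a} \<subseteq> {f b}" "\<not> {f b} \<subseteq> {f a}"
      using inj by auto
  next
    fix a b w assume "{a, b} \<in> edges G" and w: "w \<in> verts G" "w \<notin> {a, b}"
    from edge[OF this(1)] w show "\<not> {f w} \<subseteq> {f a} \<union> {f b}"
      using inj by auto
  qed
  then show ?thesis by blast
qed

definition path_graph :: "nat \<Rightarrow> nat graph" where
  "path_graph n = ({..<n}, {{i, i + 1} | i. i + 1 < n})"

text \<open>For \<open>n < 3\<close> the following is not the cycle on \<open>n\<close> vertices: it has a loop for
  \<open>n = 1\<close>, and is a single edge for \<open>n = 2\<close>.\<close>

definition cycle_graph :: "nat \<Rightarrow> nat graph" where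
  "cycle_graph n = ({..<n}, {{i, (i + 1) mod n} | i. i < n})"

lemma finite_simple_graph_path_graph: "finite_simple_graph (path_graph n)"
  unfolding finite_simple_graph_def path_graph_def by fastforce

lemma finite_simple_graph_cycle_graph:
  assumes "n \<ge> 3"
  shows "finite_simple_graph (cycle_graph n)"
proof -
  have "i \<noteq> (i + 1) mod n \<and> (i + 1) mod n < n" if "i < n" for i
    using assms that by (cases "i + 1 = n") auto
  then show ?thesis
    unfolding finite_simple_graph_def cycle_graph_def by fastforce
qed

end

theory Submission
  imports Defs
begin

text \<open>Call two members \<open>a\<close>, \<open>b\<close> of a family adjacent when no third member lies in \<open>a \<union> b\<close>, so
  that a closed walk along adjacent members of an antichain is a family for a cycle. Adjoining one
  of \<open>q\<close> new points to each member multiplies the family by \<open>q\<close>, and two products are adjacent if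
  they agree in one factor and are adjacent (or, for the new points, just distinct) in the other:
  an adjacency graph with a Hamiltonian path on \<open>M\<close> vertices thus yields one containing the product
  of that path with a complete graph on \<open>q\<close> vertices. This product has cycles of every length
  from \<open>2 * M\<close> to \<open>q * M\<close>: walk along the rows, visiting between \<open>1\<close> and \<open>q - 1\<close> of the first
  \<open>q - 1\<close> columns in each row, and return through the last column. Starting from the family
  \<open>{{}}\<close>, factors \<open>2\<close>, \<open>3\<close> and \<open>4\<close> cover all the ranges.\<close>

section \<open>Adjacency and walks in set families\<close>

definition adj :: "'a set set \<Rightarrow> 'a set \<Rightarrow> 'a set \<Rightarrow> bool" where
  "adj F a b \<longleftrightarrow> a \<noteq> b \<and> (\<forall>w\<in>F. w \<subseteq> a \<union> b \<longrightarrow> w = a \<or> w = b)"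

text \<open>Incomparability is asked of all pairs, not only of consecutive ones: two products over
  the same \<open>p\<close> stay adjacent only if no other member lies inside
  \<open>p\<close>.\<close>

definition antichain_upto :: "nat \<Rightarrow> nat set set \<Rightarrow> bool" where
  "antichain_upto t F \<longleftrightarrow> (\<forall>a\<in>F. a \<subseteq> {1..t}) \<and> (\<forall>a\<in>F. \<forall>b\<in>F. a \<subseteq> b \<longrightarrow> a = b)"

text \<open>Adjacency refers to all of \<open>F\<close>, while \<open>xs\<close> may list only some
  of its members. Dropping members only removes constraints, so a walk through part of
  \<open>F\<close> still gives a family.\<close>

definition gray_path :: "'a set set \<Rightarrow> 'a set list \<Rightarrow> bool" where
  "gray_path F xs \<longleftrightarrow> xs \<noteq> [] \<and> distinct xs \<and> set xs \<subseteq> F \<and> successively (adj F) xs"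

definition gray_cycle :: "'a set set \<Rightarrow> 'a set list \<Rightarrow> bool" where
  "gray_cycle F xs \<longleftrightarrow> gray_path F xs \<and> adj F (last xs) (hd xs)"

section \<open>Products with a complete graph\<close>

definition extend :: "nat \<Rightarrow> nat set \<Rightarrow> nat \<Rightarrow> nat set" where
  "extend t p c = insert (t + c) p"

text \<open>Fixing \<open>p\<close> gives a row, fixing \<open>c\<close> a column. Columns are
  numbered from 1 so that \<open>t + c\<close> falls outside the old ground set
  \<open>{1..t}\<close>.\<close>

definition extensions :: "nat \<Rightarrow> nat \<Rightarrow> nat set set \<Rightarrow> nat set set" where
  "extensions t q F = {extend t p c | p c. p \<in> F \<and> c \<in> {1..q}}"

lemma mem_extensions: "p \<in> F \<Longrightarrow> c \<in> {1..q} \<Longrightarrow> extend t p c \<in> extensions t q F"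
  by (auto simp: extensions_def)

lemma adj_sym: "adj F a b \<Longrightarrow> adj F b a"
  unfolding adj_def by (simp add: Un_commute) blast

text \<open>Old and new points lie in disjoint ranges, so containment splits into one condition per
  factor. Taking both sets on the right equal gives plain containment, and hence equality.\<close>

lemma extend_subset_iff:
  assumes "p \<subseteq> {1..t}" "a \<subseteq> {1..t}" "b \<subseteq> {1..t}" "c \<ge> 1" "d \<ge> 1" "e \<ge> 1"
  shows "extend t p c \<subseteq> extend t a d \<union> extend t b e \<longleftrightarrow> p \<subseteq> a \<union> b \<and> (c = d \<or> c = e)"
proof -
  have new: "t + x \<notin> y" if "y \<subseteq> {1..t}" "x \<ge> 1" for x y
    using that by (auto dest: subsetD)
  show ?thesis
    using new[OF assms(1,5)] new[OF assms(1,6)] new[OF assms(2,4)] new[OF assms(3,4)]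
    unfolding extend_def by auto
qed

lemma extend_inject:
  assumes "p \<subseteq> {1..t}" "a \<subseteq> {1..t}" "c \<ge> 1" "d \<ge> 1"
  shows "extend t p c = extend t a d \<longleftrightarrow> p = a \<and> c = d"
  using extend_subset_iff[of p t a a c d d] extend_subset_iff[of a t p p d c c] assms by auto

lemma antichain_upto_extensions:
  assumes "antichain_upto t F"
  shows "antichain_upto (t + q) (extensions t q F)"
proof -
  have sub: "p \<subseteq> {1..t}" if "p \<in> F" for p
    using assms that by (simp add: antichain_upto_def)
  have "x \<subseteq> {1..t + q}" if "x \<in> extensions t q F" for x
    using that sub by (fastforce simp: extensions_def extend_def)
  moreover have "x = y" if xy: "x \<in> extensions t q F" "y \<in> extensions t q F" "x \<subseteq> y" for x y
  proof -
    obtain p c a d where e: "x = extend t p c" "y = extend t a d" "p \<in> F" "a \<in> F" "c \<ge> 1" "d \<ge> 1"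
      using xy by (auto simp: extensions_def)
    then have "p \<subseteq> a \<and> c = d"
      using extend_subset_iff[of p t a a c d d] sub xy(3) by auto
    then show ?thesis using assms e by (auto simp: antichain_upto_def)
  qed
  ultimately show ?thesis by (simp add: antichain_upto_def)
qed

text \<open>Let \<open>extend t a e\<close> lie in the union. If \<open>p = p'\<close>, the
  antichain property forces \<open>a = p\<close> and only the two columns remain; if
  \<open>c = d\<close>, the column is fixed and adjacency in \<open>F\<close> decides
  \<open>a\<close>. Changing both coordinates at once would fail, as the two mixed products lie in
  the union.\<close>

lemma adj_extend:
  assumes F: "antichain_upto t F" and p: "p \<in> F" "p' \<in> F" and c: "c \<in> {1..q}" "d \<in> {1..q}"
    and step: "p = p' \<and> c \<noteq> d \<or> adj F p p' \<and> c = d"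
  shows "adj (extensions t q F) (extend t p c) (extend t p' d)"
proof -
  have sub: "x \<subseteq> {1..t}" if "x \<in> F" for x
    using F that by (simp add: antichain_upto_def)
  have "extend t p c \<noteq> extend t p' d"
    using step extend_inject[of p t p' c d] sub p c by (auto simp: adj_def)
  moreover have "w = extend t p c \<or> w = extend t p' d"
    if w: "w \<in> extensions t q F" "w \<subseteq> extend t p c \<union> extend t p' d" for w
  proof -
    obtain a e where a: "w = extend t a e" "a \<in> F" "e \<ge> 1"
      using w(1) by (auto simp: extensions_def)
    then have "a \<subseteq> p \<union> p' \<and> (e = c \<or> e = d)"
      using extend_subset_iff[of a t p p' e c d] sub p c w(2) by auto
    moreover from this have "a = p" if "p = p'"
      using F a(2) p(1) that by (simp add: antichain_upto_def)
    moreover have "a = p \<or> a = p'" if "adj F p p'" "a \<subseteq> p \<union> p'"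
      using that a(2) unfolding adj_def by blast
    ultimately show ?thesis
      using step a(1) by metis
  qed
  ultimately show ?thesis by (simp add: adj_def)
qed

section \<open>Walks inside a product\<close>

lemma adj_extend_column:
  assumes "antichain_upto t F" "p \<in> F" "c \<in> {1..q}" "d \<in> {1..q}" "c \<noteq> d"
  shows "adj (extensions t q F) (extend t p c) (extend t p d)"
  using adj_extend[OF assms(1)] assms by simp

lemma adj_extend_row:
  assumes "antichain_upto t F" "p \<in> F" "p' \<in> F" "adj F p p'" "c \<in> {1..q}"
  shows "adj (extensions t q F) (extend t p c) (extend t p' c)"
  using adj_extend[OF assms(1)] assms by simp

text \<open>Supplies the columns visited in one row: their number and the entry column are
  prescribed, the order is free because any two columns are adjacent.\<close>

lemma ex_distinct_list_hd:
  assumes "finite C" "c \<in> C" "1 \<le> r" "r \<le> card C"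
  shows "\<exists>cs. distinct cs \<and> set cs \<subseteq> C \<and> length cs = r \<and> cs \<noteq> [] \<and> hd cs = c"
proof -
  have "r - 1 \<le> card (C - {c})" using assms by simp
  then obtain D where D: "D \<subseteq> C - {c}" "card D = r - 1" "finite D"
    by (rule obtain_subset_with_card_n)
  obtain ds where "set ds = D" "distinct ds"
    using finite_distinct_list[OF D(3)] by blast
  then show ?thesis
    using D assms distinct_card[of ds] by (intro exI[of _ "c # ds"]) auto
qed

lemma gray_path_row:
  assumes "antichain_upto t F" "p \<in> F" "distinct cs" "set cs \<subseteq> {1..q}" "cs \<noteq> []"
  shows "gray_path (extensions t q F) (map (extend t p) cs)"
proof -
  have "p \<subseteq> {1..t}" using assms by (simp add: antichain_upto_def)
  then have "inj_on (extend t p) (set cs)"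
    using assms(4) by (auto simp: inj_on_def extend_inject subset_iff)
  moreover have "successively (\<lambda>c d. adj (extensions t q F) (extend t p c) (extend t p d)) cs"
    using assms(3,4)
  proof (induction cs)
    case (Cons c cs)
    then show ?case
      using adj_extend_column[OF assms(1,2), of c q "hd cs"]
      by (cases cs) auto
  qed simp
  ultimately show ?thesis
    using assms by (auto simp: gray_path_def successively_map distinct_map mem_extensions subset_iff)
qed

lemma gray_path_append:
  assumes "gray_path F xs" "gray_path F ys" "set xs \<inter> set ys = {}" "adj F (last xs) (hd ys)"
  shows "gray_path F (xs @ ys)"
  using assms by (auto simp: gray_path_def successively_append_iff)

lemma gray_path_ConsD:
  assumes "gray_path F (p # ps)" "ps \<noteq> []"
  shows "gray_path F ps \<and> adj F p (hd ps) \<and> p \<notin> set ps \<and> p \<in> F"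
  using assms by (auto simp: gray_path_def successively_Cons)

text \<open>Induction over the rows. The entry column \<open>c\<close> is arbitrary because it is
  inherited from the row before; column \<open>q\<close> is kept free for the return, although
  adjacency is already that of the family with all \<open>q\<close> columns.\<close>

lemma gray_path_snake:
  assumes F: "antichain_upto t F"
    and "gray_path F ps" "c \<in> {1..q - 1}" "length ps \<le> m" "m \<le> (q - 1) * length ps"
  shows "\<exists>ys d. gray_path (extensions t q F) ys \<and> length ys = m \<and>
           set ys \<subseteq> extensions t (q - 1) (set ps) \<and>
           hd ys = extend t (hd ps) c \<and> d \<in> {1..q - 1} \<and> last ys = extend t (last ps) d"
  using assms(2-)
proof (induction ps arbitrary: c m)
  case Nil
  then show ?case by (simp add: gray_path_def)
next
  case (Cons p ps)
  have p: "p \<in> F" and psF: "set ps \<subseteq> F" using Cons.prems(1) by (auto simp: gray_path_def)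
  have row: "\<exists>cs. distinct cs \<and> set cs \<subseteq> {1..q - 1} \<and> length cs = r \<and> cs \<noteq> [] \<and> hd cs = c \<and>
      last cs \<in> {1..q - 1} \<and> gray_path (extensions t q F) (map (extend t p) cs)"
    if "1 \<le> r" "r \<le> q - 1" for r
  proof -
    have "r \<le> card {1..q - 1}" using that by simp
    from ex_distinct_list_hd[OF finite_atLeastAtMost Cons.prems(2) \<open>1 \<le> r\<close> this]
    obtain cs where cs: "distinct cs" "set cs \<subseteq> {1..q - 1}" "length cs = r" "cs \<noteq> []" "hd cs = c"
      by blast
    moreover have "set cs \<subseteq> {1..q}" using cs(2) by (auto simp: subset_iff)
    ultimately show ?thesis
      using gray_path_row[OF F p] last_in_set[of cs] by blast
  qed
  show ?case
  proof (cases "ps = []")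
    case True
    then have "1 \<le> m" "m \<le> q - 1" using Cons.prems by auto
    from row[OF this] obtain cs where "distinct cs" "set cs \<subseteq> {1..q - 1}" "length cs = m" "cs \<noteq> []" "hd cs = c"
      "last cs \<in> {1..q - 1}" "gray_path (extensions t q F) (map (extend t p) cs)"
      by blast
    with True show ?thesis
      by (intro exI[of _ "map (extend t p) cs"] exI[of _ "last cs"])
        (auto simp: hd_map last_map intro!: mem_extensions)
  next
    case False
    \<comment> \<open>Greedy choice: as many columns as possible while leaving at least one visit
      for each later row.\<close>
    define r where "r = min (q - 1) (m - length ps)"
    have r: "1 \<le> r" "r \<le> q - 1" "r \<le> m" "length ps \<le> m - r"
      "m - r \<le> (q - 1) * length ps"
      using Cons.prems(2-) by (auto simp: r_def min_def)
    obtain cs where cs: "distinct cs" "set cs \<subseteq> {1..q - 1}" "length cs = r" "cs \<noteq> []" "hd cs = c"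
      "last cs \<in> {1..q - 1}" "gray_path (extensions t q F) (map (extend t p) cs)"
      using row[OF r(1,2)] by blast
    note ps = gray_path_ConsD[OF Cons.prems(1) False]
    \<comment> \<open>The next row is entered in the column where this one ends, so the step between
      rows changes only the row.\<close>
    obtain ys d where ys: "gray_path (extensions t q F) ys" "length ys = m - r"
      "set ys \<subseteq> extensions t (q - 1) (set ps)"
      "hd ys = extend t (hd ps) (last cs)" "d \<in> {1..q - 1}" "last ys = extend t (last ps) d"
      using Cons.IH[of "last cs" "m - r"] ps cs(6) r by blast
    have sub: "x \<subseteq> {1..t}" if "x \<in> F" for x
      using F that by (simp add: antichain_upto_def)
    have "extend t p x \<noteq> extend t p' y" if "p' \<in> set ps" "x \<in> set cs" "y \<in> {1..q - 1}" for x p' y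
    proof -
      have "p' \<in> F" "p \<noteq> p'" "x \<ge> 1" "y \<ge> 1" using that cs(2) psF ps by auto
      then show ?thesis using sub p by (simp add: extend_inject)
    qed
    then have disj: "set (map (extend t p) cs) \<inter> set ys = {}"
      using ys(3) by (fastforce simp: extensions_def)
    have "hd ps \<in> F" "last cs \<in> {1..q}" using hd_in_set[OF False] psF cs(6) by auto
    then have "adj (extensions t q F) (last (map (extend t p) cs)) (hd ys)"
      using adj_extend_row[OF F p] ps cs(4) ys(4) by (simp add: last_map)
    with gray_path_append[OF cs(7) ys(1) disj]
    have "gray_path (extensions t q F) (map (extend t p) cs @ ys)" .
    moreover have "set (map (extend t p) cs @ ys) \<subseteq> extensions t (q - 1) (set (p # ps))"
      using cs(2) ys(3) by (fastforce simp: extensions_def)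
    moreover have "ys \<noteq> []" using ys(1) by (simp add: gray_path_def)
    ultimately show ?thesis
      using cs ys r False
      by (intro exI[of _ "map (extend t p) cs @ ys"] exI[of _ d])
        (simp add: hd_map)
  qed
qed

text \<open>The return takes \<open>length ps\<close> members, one per row. The bounds on
  \<open>n\<close> say exactly that the snake's share \<open>n - length ps\<close> lies between 1
  and \<open>q - 1\<close> visits per row on average.\<close>

lemma gray_cycle_extensions:
  assumes F: "antichain_upto t F" and ps: "gray_path F ps"
    and q: "q \<ge> 2" and n: "2 * length ps \<le> n" "n \<le> q * length ps"
  shows "\<exists>xs. gray_cycle (extensions t q F) xs \<and> length xs = n"
proof -
  have ne: "ps \<noteq> []" and psF: "set ps \<subseteq> F" using ps by (auto simp: gray_path_def)
  have sub: "x \<subseteq> {1..t}" if "x \<in> F" for x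
    using F that by (simp add: antichain_upto_def)
  have "n - length ps \<le> (q - 1) * length ps" "length ps \<le> n - length ps"
    using n by (simp_all add: diff_mult_distrib)
  moreover have "1 \<in> {1..q - 1}" using q by simp
  ultimately have "\<exists>ys d. gray_path (extensions t q F) ys \<and> length ys = n - length ps \<and>
      set ys \<subseteq> extensions t (q - 1) (set ps) \<and>
      hd ys = extend t (hd ps) 1 \<and> d \<in> {1..q - 1} \<and> last ys = extend t (last ps) d"
    by (intro gray_path_snake[OF F ps])
  then obtain ys d where ys: "gray_path (extensions t q F) ys" "length ys = n - length ps"
      "set ys \<subseteq> extensions t (q - 1) (set ps)"
      "hd ys = extend t (hd ps) 1" "d \<in> {1..q - 1}" "last ys = extend t (last ps) d"
    by blast
  have ysne: "ys \<noteq> []" using ys(1) by (simp add: gray_path_def)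
  \<comment> \<open>Reversed, the return starts in the row where the snake ends and ends in the row
    where it starts. Both junctions change only the column, since \<open>d < q\<close> and
    \<open>1 < q\<close>.\<close>
  define zs where "zs = rev (map (\<lambda>p. extend t p q) ps)"
  have zs: "gray_path (extensions t q F) zs"
  proof -
    have "successively (\<lambda>p p'. adj (extensions t q F) (extend t p' q) (extend t p q)) ps"
    proof (rule successively_mono)
      show "successively (adj F) ps" using ps by (simp add: gray_path_def)
      show "adj (extensions t q F) (extend t p' q) (extend t p q)"
        if "p \<in> set ps" "p' \<in> set ps" "adj F p p'" for p p'
        using adj_extend_row[OF F _ _ adj_sym[OF that(3)], of q q] that(1,2) psF q by auto
    qed
    moreover have "inj_on (\<lambda>p. extend t p q) (set ps)"
    proof (rule inj_onI)
      fix x y assume "x \<in> set ps" "y \<in> set ps" "extend t x q = extend t y q"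
      then show "x = y" using extend_inject[of x t y q q] sub psF q by auto
    qed
    ultimately show ?thesis
      using ps q unfolding zs_def
      by (auto simp: gray_path_def successively_map successively_rev distinct_map mem_extensions subset_iff)
  qed
  have "extend t p c \<noteq> extend t p' q" if "p \<in> set ps" "p' \<in> set ps" "c \<in> {1..q - 1}" for p p' c
  proof -
    have "p \<in> F" "p' \<in> F" "c \<ge> 1" "q \<ge> 1" "c \<noteq> q" using that psF q by auto
    then show ?thesis using sub by (simp add: extend_inject)
  qed
  then have disj: "set ys \<inter> set zs = {}"
    using ys(3) unfolding zs_def by (fastforce simp: extensions_def)
  have lF: "last ps \<in> F" and hF: "hd ps \<in> F" using ne psF by auto
  have hz: "hd zs = extend t (last ps) q" and lz: "last zs = extend t (hd ps) q"
    using ne by (simp_all add: zs_def hd_rev last_rev hd_map last_map)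
  have "adj (extensions t q F) (last ys) (hd zs)"
    using adj_extend_column[OF F lF, of d q q] ys(5,6) hz by auto
  moreover have "adj (extensions t q F) (last zs) (hd ys)"
    using adj_extend_column[OF F hF, of q q 1] ys(4) q lz by auto
  ultimately have "gray_cycle (extensions t q F) (ys @ zs)"
    using gray_path_append[OF ys(1) zs disj] ysne zs by (simp add: gray_cycle_def gray_path_def)
  moreover have "length (ys @ zs) = n" using ys(2) n by (simp add: zs_def)
  ultimately show ?thesis by blast
qed

section \<open>Iterating the product\<close>

lemma ex_gray_cycle_mult:
  assumes "\<exists>F xs. antichain_upto t F \<and> gray_path F xs \<and> length xs = M"
    and "q \<ge> 2" "2 * M \<le> n" "n \<le> q * M"
  shows "\<exists>F xs. antichain_upto (t + q) F \<and> gray_cycle F xs \<and> length xs = n"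
proof -
  obtain F ps where F: "antichain_upto t F" "gray_path F ps" "length ps = M"
    using assms(1) by blast
  then obtain xs where "gray_cycle (extensions t q F) xs" "length xs = n"
    using gray_cycle_extensions[of t F ps q n] assms(2-) by blast
  with antichain_upto_extensions[OF F(1)] show ?thesis by blast
qed

text \<open>Each factor 3 costs three points. The claim is about paths because for
  \<open>k = 0\<close> the only member is not adjacent to itself; every later path is a cycle
  without its closing step.\<close>

lemma ex_gray_path_pow3:
  "\<exists>F xs. antichain_upto (3 * k) F \<and> gray_path F xs \<and> length xs = 3 ^ k"
proof (induction k)
  case 0
  show ?case
    by (intro exI[of _ "{{}}"] exI[of _ "[{}]"]) (simp add: antichain_upto_def gray_path_def)
next
  case (Suc k)
  show ?case
    using ex_gray_cycle_mult[OF Suc, of 3 "3 ^ Suc k"] by (auto simp: gray_cycle_def add.commute)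
qed

section \<open>From closed walks to families for cycles\<close>

lemma is_graph_cff_cycle_graph:
  assumes F: "antichain_upto t F" and xs: "gray_cycle F xs"
  shows "is_graph_cff (cycle_graph (length xs)) t ((!) xs)"
proof -
  let ?n = "length xs"
  have xsF: "set xs \<subseteq> F" and d: "distinct xs" and ne: "xs \<noteq> []"
    using xs by (auto simp: gray_cycle_def gray_path_def)
  have inF: "xs ! i \<in> F" if "i < ?n" for i using xsF that by auto
  have next_adj: "adj F (xs ! i) (xs ! ((i + 1) mod ?n))" if "i < ?n" for i
  proof (cases "i + 1 = ?n")
    case True
    then have "xs ! i = last xs" using ne by (metis add_diff_cancel_right' last_conv_nth)
    with True show ?thesis using xs ne by (simp add: gray_cycle_def hd_conv_nth)
  next
    case False
    then show ?thesis
      using xs that by (auto simp: gray_cycle_def gray_path_def successively_conv_nth)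
  qed
  have edge: "a < ?n \<and> b < ?n \<and> adj F (xs ! a) (xs ! b)"
    if "{a, b} \<in> edges (cycle_graph ?n)" for a b
  proof -
    obtain i where i: "{a, b} = {i, (i + 1) mod ?n}" "i < ?n"
      using \<open>{a, b} \<in> _\<close> by (auto simp: cycle_graph_def)
    moreover have "(i + 1) mod ?n < ?n" using ne by (intro mod_less_divisor) simp
    ultimately show ?thesis
      using next_adj[OF i(2)] adj_sym by (auto simp: doubleton_eq_iff)
  qed
  \<comment> \<open>The antichain property gives incomparability along edges, adjacency gives the
    condition on third vertices, and distinctness of \<open>xs\<close> turns different positions
    into different sets.\<close>
  show ?thesis
    unfolding is_graph_cff_def
  proof (intro conjI ballI allI impI)
    fix v assume "v \<in> verts (cycle_graph ?n)"
    then show "xs ! v \<subseteq> {1..t}"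
      using F inF by (auto simp: cycle_graph_def antichain_upto_def)
  next
    fix a b assume "{a, b} \<in> edges (cycle_graph ?n)"
    from edge[OF this] show "\<not> xs ! a \<subseteq> xs ! b" "\<not> xs ! b \<subseteq> xs ! a"
      using F inF unfolding antichain_upto_def adj_def by metis+
  next
    fix a b w
    assume e: "{a, b} \<in> edges (cycle_graph ?n)" and w: "w \<in> verts (cycle_graph ?n)" "w \<notin> {a, b}"
    have "w < ?n" using w(1) by (simp add: cycle_graph_def)
    then show "\<not> xs ! w \<subseteq> xs ! a \<union> xs ! b"
      using edge[OF e] inF[of w] w(2) d unfolding adj_def by (auto simp: nth_eq_iff_index_eq)
  qed
qed

lemma cff_number_cycle_graph_le:
  assumes "\<exists>F xs. antichain_upto t F \<and> gray_cycle F xs \<and> length xs = n"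
  shows "cff_number (cycle_graph n) \<le> t"
  using assms is_graph_cff_cycle_graph unfolding cff_number_def by (blast intro: Least_le)

section \<open>Monotonicity under subgraphs\<close>

lemma is_graph_cff_subgraph:
  assumes "is_graph_cff G t B" "verts H \<subseteq> verts G" "edges H \<subseteq> edges G"
  shows "is_graph_cff H t B"
  using assms unfolding is_graph_cff_def by blast

text \<open>An optimal family for \<open>G\<close> also serves \<open>H\<close>. That one exists, so
  that \<open>LEAST\<close> is attained, comes from \<open>ex_graph_cff\<close>.\<close>

lemma cff_number_subgraph_le:
  assumes "finite_simple_graph G" "verts H \<subseteq> verts G" "edges H \<subseteq> edges G"
  shows "cff_number H \<le> cff_number G"
proof -
  have "\<exists>B. is_graph_cff G (cff_number G) B"
    unfolding cff_number_def by (rule LeastI_ex) (rule ex_graph_cff[OF assms(1)])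
  then show ?thesis
    using is_graph_cff_subgraph[OF _ assms(2,3)] unfolding cff_number_def[of H]
    by (blast intro: Least_le)
qed

lemma cff_number_path_graph_le_cycle_graph:
  assumes "n \<ge> 3"
  shows "cff_number (path_graph n) \<le> cff_number (cycle_graph n)"
proof (rule cff_number_subgraph_le[OF finite_simple_graph_cycle_graph[OF assms]])
  show "edges (path_graph n) \<subseteq> edges (cycle_graph n)"
  proof
    fix e assume "e \<in> edges (path_graph n)"
    then obtain i where "e = {i, i + 1}" "i + 1 < n" by (auto simp: path_graph_def)
    then have "e = {i, (i + 1) mod n} \<and> i < n" by simp
    then show "e \<in> edges (cycle_graph n)" by (auto simp: cycle_graph_def)
  qed
qed (simp add: path_graph_def cycle_graph_def)

section \<open>The three ranges\<close>

theorem theorem6p12: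
  fixes n :: nat
  assumes "n \<ge> 3"
  shows "(\<forall>k::nat. k \<ge> 1 \<longrightarrow> n \<in> {2 * 3 ^ (k - 1)<..3 ^ k} \<longrightarrow>
            cff_number (path_graph n) \<le> cff_number (cycle_graph n) \<and>
            cff_number (cycle_graph n) \<le> 3 * k) \<and>
         (\<forall>k::nat. k \<ge> 1 \<longrightarrow> n \<in> {3 ^ k<..4 * 3 ^ (k - 1)} \<longrightarrow>
            cff_number (path_graph n) \<le> cff_number (cycle_graph n) \<and>
            cff_number (cycle_graph n) \<le> 3 * k + 1) \<and>
         (\<forall>k::nat. k \<ge> 1 \<longrightarrow> n \<in> {4 * 3 ^ (k - 1)<..2 * 3 ^ k} \<longrightarrow>
            cff_number (path_graph n) \<le> cff_number (cycle_graph n) \<and>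
            cff_number (cycle_graph n) \<le> 3 * k + 2)"
proof (intro conjI allI impI)
  fix k :: nat assume "k \<ge> 1" and n: "n \<in> {2 * 3 ^ (k - 1)<..3 ^ k}"
  then obtain j where k: "k = Suc j" by (cases k) auto
  \<comment> \<open>A last factor 3 on \<open>3 ^ j\<close> members reaches all lengths from
    \<open>2 * 3 ^ j\<close> to \<open>3 * 3 ^ j\<close>, with \<open>3 * j + 3\<close>
    points.\<close>
  show "cff_number (cycle_graph n) \<le> 3 * k"
    using cff_number_cycle_graph_le[OF ex_gray_cycle_mult[OF ex_gray_path_pow3[of j], of 3 n]] n
    by (simp add: k)
next
  fix k :: nat assume "k \<ge> 1" and n: "n \<in> {3 ^ k<..4 * 3 ^ (k - 1)}"
  then obtain j where k: "k = Suc j" by (cases k) auto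
  \<comment> \<open>A last factor 4 reaches up to \<open>4 * 3 ^ j\<close>, with
    \<open>3 * j + 4 = 3 * k + 1\<close> points.\<close>
  show "cff_number (cycle_graph n) \<le> 3 * k + 1"
    using cff_number_cycle_graph_le[OF ex_gray_cycle_mult[OF ex_gray_path_pow3[of j], of 4 n]] n
    by (simp add: k)
next
  fix k :: nat assume "k \<ge> 1" and n: "n \<in> {4 * 3 ^ (k - 1)<..2 * 3 ^ k}"
  then obtain j where k: "k = Suc j" by (cases k) auto
  \<comment> \<open>Factor 2 comes first, giving a path on \<open>2 * 3 ^ j\<close> members; a last
    factor 3 then covers \<open>4 * 3 ^ j\<close> to \<open>6 * 3 ^ j = 2 * 3 ^ k\<close>, with
    \<open>3 * j + 5 = 3 * k + 2\<close> points.\<close>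
  have "\<exists>F xs. antichain_upto (3 * j + 2) F \<and> gray_path F xs \<and> length xs = 2 * 3 ^ j"
    using ex_gray_cycle_mult[OF ex_gray_path_pow3[of j], of 2 "2 * 3 ^ j"]
    by (auto simp: gray_cycle_def)
  from cff_number_cycle_graph_le[OF ex_gray_cycle_mult[OF this, of 3 n]] n
  show "cff_number (cycle_graph n) \<le> 3 * k + 2"
    by (simp add: k)
qed (rule cff_number_path_graph_le_cycle_graph[OF assms])+

end
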